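(* Let $k\ge 1$ and let $St_{2^k}\subseteq\mathcal{F}_{2,k}$ denote the set of standard tableaux of shape $2^k$. Then $$D^{St_{2^k}}(x,t)=\frac{1-x}{1-x+(x-1)\frac{t}{k!}+\sum_{n\ge 2}\frac{((x-1)t)^n}{\prod_{i=1}^{k}(n+i-1)\downarrow_n}}$$ and $$A^{St_{2^k}}(t)=\frac{1}{1-\frac{t}{k!}+\sum_{n\ge 2}\frac{(-t)^n}{\prod_{i=1}^{k}(n+i-1)\downarrow_n}}.$$
   Context: $\mathcal{F}_{n,k}$ is the set of all fillings $F$ of the $k\times n$ rectangular array ($k$ rows, $n$ columns) with the integers $1,\dots,kn$, each used once, such that the elements in each column increase from bottom to top. A standard tableau of shape $n^k$ is an $F\in\mathcal{F}_{n,k}$ whose entries also increase in each row from left to right. For a filling of a $k\times n$ array by distinct positive integers with columns increasing from bottom to top, $\mathrm{red}(F)\in\mathcal{F}_{n,k}$ is obtained by replacing the $i$-th smallest entry by $i$. $F[i,i+1]$ is the $k\times 2$ filling formed by columns $i$ and $i+1$ of $F$. For $\Upsilon\subseteq\mathcal{F}_{2,k}$, $F\in\mathcal{F}_{n,k}$ has an $\Upsilon$-match starting at position $i$ ($1\le i\le n-1$) if $\mathrm{red}(F[i,i+1])\in\Upsilon$; $\Upsilon\text{-mch}(F)$ is the number of $\Upsilon$-matches in $F$, and $A^{\Upsilon}_{n,k}$ is the number of $F\in\mathcal{F}_{n,k}$ with no $\Upsilon$-matches. Define $$D^{\Upsilon}(x,t)=1+\sum_{n\ge 1}\frac{t^n}{(kn)!}\sum_{F\in\mathcal{F}_{n,k}}x^{\Upsilon\text{-mch}(F)},\qquad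 A^{\Upsilon}(t)=D^{\Upsilon}(0,t)=1+\sum_{n\ge1}\frac{A^{\Upsilon}_{n,k}t^n}{(kn)!}.$$ Falling factorials: $(m)\downarrow_0=1$ and $(m)\downarrow_n=m(m-1)\cdots(m-n+1)$ for $n>0$. The identities are of formal power series in $t$ (with coefficients in $\mathbb{Q}(x)$ for the first). *)

theory Defs
  imports
    "HOL-Library.FuncSet"
    "HOL-Computational_Algebra.Fraction_Field"
    "HOL-Computational_Algebra.Formal_Power_Series"
    "HOL-Computational_Algebra.Polynomial_Factorial"
begin

text \<open>
  A cell of the array with \<open>k\<close> rows and \<open>n\<close> columns is a pair \<open>(r, c)\<close> of a row \<open>r\<close>, counted
  from the bottom, and a column \<open>c\<close>, both starting at 1.  A filling is an extensional function
  on the cells (it is \<^const>\<open>undefined\<close> elsewhere), so that different functions are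
  different fillings and the cardinalities and sums below are the intended ones.
\<close>

definition cells :: "nat \<Rightarrow> nat \<Rightarrow> (nat \<times> nat) set" where
  "cells n k = {1..k} \<times> {1..n}"

definition fillings :: "nat \<Rightarrow> nat \<Rightarrow> (nat \<times> nat \<Rightarrow> nat) set" where
  "fillings n k =
     {F \<in> extensional (cells n k). bij_betw F (cells n k) {1..k * n} \<and>
        (\<forall>c\<in>{1..n}. \<forall>r\<in>{1..k}. \<forall>r'\<in>{1..k}. r < r' \<longrightarrow> F (r, c) < F (r', c))}"

definition standard_tableaux :: "nat \<Rightarrow> nat \<Rightarrow> (nat \<times> nat \<Rightarrow> nat) set" where
  "standard_tableaux n k =
     {F \<in> fillings n k.
        \<forall>r\<in>{1..k}. \<forall>c\<in>{1..n}. \<forall>c'\<in>{1..n}. c < c' \<longrightarrow> F (r, c) < F (r, c')}"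

text \<open>When the entries of \<open>F\<close> are distinct, each entry is replaced by its rank among them.\<close>

definition red :: "nat \<Rightarrow> nat \<Rightarrow> (nat \<times> nat \<Rightarrow> nat) \<Rightarrow> (nat \<times> nat \<Rightarrow> nat)" where
  "red n k F = (\<lambda>p\<in>cells n k. card {e \<in> F ` cells n k. e \<le> F p})"

text \<open>The filling of two columns formed by the columns \<open>i\<close> and \<open>i + 1\<close> of \<open>F\<close>.\<close>

definition two_cols :: "nat \<Rightarrow> (nat \<times> nat \<Rightarrow> nat) \<Rightarrow> nat \<Rightarrow> (nat \<times> nat \<Rightarrow> nat)" where
  "two_cols k F i = (\<lambda>(r, c)\<in>cells 2 k. F (r, i + c - 1))"

definition mch :: "nat \<Rightarrow> (nat \<times> nat \<Rightarrow> nat) set \<Rightarrow> nat \<Rightarrow> (nat \<times> nat \<Rightarrow> nat) \<Rightarrow> nat" where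
  "mch k \<Upsilon> n F = card {i \<in> {1..<n}. red 2 k (two_cols k F i) \<in> \<Upsilon>}"

definition num_no_match :: "nat \<Rightarrow> (nat \<times> nat \<Rightarrow> nat) set \<Rightarrow> nat \<Rightarrow> nat" where
  "num_no_match k \<Upsilon> n = card {F \<in> fillings n k. mch k \<Upsilon> n F = 0}"

text \<open>
  The series in \<open>t\<close> whose coefficients are polynomials in \<open>x\<close>; the parameter \<open>x\<close> is an element
  of a coefficient field, which can be a rational function field with \<open>x\<close> as its indeterminate.
\<close>

definition D_series :: "nat \<Rightarrow> (nat \<times> nat \<Rightarrow> nat) set \<Rightarrow> 'a::field_char_0 \<Rightarrow> 'a fps" where
  "D_series k \<Upsilon> x =
     1 + Abs_fps (\<lambda>n. if n \<ge> 1
                      then (\<Sum>F\<in>fillings n k. x ^ mch k \<Upsilon> n F) / fact (k * n) else 0)"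

definition A_series :: "nat \<Rightarrow> (nat \<times> nat \<Rightarrow> nat) set \<Rightarrow> rat fps" where
  "A_series k \<Upsilon> =
     1 + Abs_fps (\<lambda>n. if n \<ge> 1
                      then of_nat (num_no_match k \<Upsilon> n) / fact (k * n) else 0)"

lemma finite_fillings: "finite (fillings n k)"
proof (rule finite_subset)
  show "fillings n k \<subseteq> (\<Pi>\<^sub>E p\<in>cells n k. {1..k * n})"
    by (auto simp: fillings_def PiE_def Pi_def bij_betw_def)
  show "finite (\<Pi>\<^sub>E p\<in>cells n k. {1..k * n})"
    by (rule finite_PiE) (auto simp: cells_def)
qed

lemma A_series_eq_D_series_0: "A_series k \<Upsilon> = D_series k \<Upsilon> 0"
proof -
  have "(\<Sum>F\<in>fillings n k. (0::rat) ^ mch k \<Upsilon> n F) = of_nat (num_no_match k \<Upsilon> n)" for n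
    using finite_fillings[of n k]
    by (simp add: num_no_match_def power_0_left sum.If_cases Int_def)
  then show ?thesis by (simp only: A_series_def D_series_def)
qed

definition falling :: "'a::comm_ring_1 \<Rightarrow> nat \<Rightarrow> 'a" where
  "falling m n = (\<Prod>j<n. m - of_nat j)"

text \<open>The indeterminate of the field of rational functions over the rationals.\<close>

definition indet :: "rat poly fract" where
  "indet = to_fract [:0, 1:]"

end

theory Submission
  imports Defs "Jordan_Normal_Form.Determinant"
begin

text \<open>
  A match at position \<open>i\<close> means that all rows ascend from column \<open>i\<close> to column \<open>i + 1\<close>.  Writing \<open>x\<close> as
  \<open>1 + (x - 1)\<close> at one position after the other, one expresses the weight \<open>x\<close> to the number of
  matches as a sum over all \<open>m\<close> such that the first \<open>m\<close> columns form a standard tableau (up to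
  reduction), with weight \<open>(x - 1)\<^bsup>m - 1\<^esup>\<close>, times \<open>x\<close> to the number of matches within the remaining
  \<open>n - m\<close> columns (\<open>power_card_eq_sum_initial_run\<close>).  The position between the two groups of columns
  carries no condition any more.  Hence, after choosing which \<open>k m\<close> of the \<open>k n\<close> numbers go to the
  first \<open>m\<close> columns, the two groups are filled independently, which yields the recurrence
  \<open>match_sum_rec\<close>.  In terms of generating functions with denominators \<open>(k n)!\<close> it says that
  \<open>D (1 - R) = 1\<close>, where \<open>R\<close> is the series with coefficients \<open>(x - 1)\<^bsup>m - 1\<^esup> f\<^sub>m / (k m)!\<close> and \<open>f\<^sub>m\<close> is the
  number of standard tableaux with \<open>k\<close> rows and \<open>m\<close> columns.

  It remains to know that \<open>f\<^sub>m\<close> is \<open>(k m)!\<close> divided by the product of the hook lengths.  This follows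
  from Aitken's formula: a diagram with row lengths \<open>\<lambda>\<^sub>i\<close> and \<open>N\<close> cells has
  \<open>N! det (1/(\<lambda>\<^sub>i - i + j)!)\<close> standard tableaux (\<open>card_labellings_diagram\<close>).  Both sides satisfy the
  recurrence for the removal of the cell with the largest entry, for the determinant by a
  short computation with the Leibniz expansion (\<open>sum_det_aitken_mat\<close>).  For a rectangle the
  matrix is a product of two triangular matrices (\<open>det_aitken_mat_const\<close>).
\<close>

section \<open>Order-preserving labellings of finite sets\<close>

text \<open>
  The bijective labellings of the set \<open>C\<close> by the set \<open>V\<close> that increase along the relation \<open>R\<close>; they
  are the linear extensions of \<open>R\<close> when \<open>V = {1..card C}\<close>.  The relation \<open>R\<close> need not be
  transitive, so a few generating inequalities suffice to describe it.  As for fillings,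
  labellings are extensional, so that they can be counted.
\<close>

definition labellings :: "('a \<Rightarrow> 'a \<Rightarrow> bool) \<Rightarrow> 'a set \<Rightarrow> nat set \<Rightarrow> ('a \<Rightarrow> nat) set" where
  "labellings R C V =
     {F \<in> extensional C. bij_betw F C V \<and> (\<forall>x\<in>C. \<forall>y\<in>C. R x y \<longrightarrow> F x < F y)}"

lemma labellings_cong:
  assumes "\<And>x y. x \<in> C \<Longrightarrow> y \<in> C \<Longrightarrow> R x y \<longleftrightarrow> R' x y"
  shows "labellings R C V = labellings R' C V"
  using assms by (auto simp: labellings_def)

lemma finite_labellings:
  assumes "finite C" "finite V"
  shows "finite (labellings R C V)"
proof (rule finite_subset)
  show "labellings R C V \<subseteq> (\<Pi>\<^sub>E x\<in>C. V)"
    by (auto simp: labellings_def PiE_def Pi_def bij_betw_def)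
  show "finite (\<Pi>\<^sub>E x\<in>C. V)"
    using assms by (intro finite_PiE)
qed

lemma labellings_empty: "labellings R {} {} = {\<lambda>_. undefined}"
  by (auto simp: labellings_def bij_betw_def)

text \<open>
  Labellings can be transported along an isomorphism \<open>h\<close> of the underlying relations together with
  an order isomorphism \<open>\<phi>\<close> of the sets of labels.
\<close>

lemma bij_betw_labellings:
  assumes h: "bij_betw h C' C"
    and R: "\<And>x y. x \<in> C' \<Longrightarrow> y \<in> C' \<Longrightarrow> R' x y \<longleftrightarrow> R (h x) (h y)"
    and \<phi>: "bij_betw \<phi> V V'" "strict_mono_on V \<phi>"
  shows "bij_betw (\<lambda>F. \<lambda>x\<in>C'. \<phi> (F (h x))) (labellings R C V) (labellings R' C' V')"
proof -
  define h' where "h' = inv_into C' h"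
  define \<psi> where "\<psi> = inv_into V \<phi>"
  have h': "bij_betw h' C C'" and \<psi>: "bij_betw \<psi> V' V"
    using h \<phi> by (auto simp: h'_def \<psi>_def bij_betw_inv_into)
  have hh [simp]: "h (h' y) = y" if "y \<in> C" for y
    using h that by (simp add: h'_def bij_betw_inv_into_right)
  have hh' [simp]: "h' (h x) = x" if "x \<in> C'" for x
    using h that by (simp add: h'_def bij_betw_inv_into_left)
  have pp [simp]: "\<phi> (\<psi> y) = y" if "y \<in> V'" for y
    using \<phi> that by (simp add: \<psi>_def bij_betw_inv_into_right)
  have pp' [simp]: "\<psi> (\<phi> x) = x" if "x \<in> V" for x
    using \<phi> that by (simp add: \<psi>_def bij_betw_inv_into_left)
  have hC: "h x \<in> C" if "x \<in> C'" for x using h that by (auto simp: bij_betw_def)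
  have hC': "h' x \<in> C'" if "x \<in> C" for x using h' that by (auto simp: bij_betw_def)
  have V: "F x \<in> V" if "F \<in> labellings R C V" "x \<in> C" for F x
    using that by (auto simp: labellings_def bij_betw_def)
  have V': "F x \<in> V'" if "F \<in> labellings R' C' V'" "x \<in> C'" for F x
    using that by (auto simp: labellings_def bij_betw_def)
  have mono: "\<phi> a < \<phi> b \<longleftrightarrow> a < b" if "a \<in> V" "b \<in> V" for a b
    using \<phi>(2) that by (simp add: strict_mono_on_less)
  have mono': "\<psi> a < \<psi> b" if "a \<in> V'" "b \<in> V'" "a < b" for a b
    using mono[of "\<psi> a" "\<psi> b"] that \<psi> by (auto simp: bij_betw_def)
  show ?thesis
  proof (rule bij_betw_byWitness[where f' = "\<lambda>G. \<lambda>y\<in>C. \<psi> (G (h' y))"])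
    show "\<forall>F\<in>labellings R C V. (\<lambda>y\<in>C. \<psi> ((\<lambda>x\<in>C'. \<phi> (F (h x))) (h' y))) = F"
    proof
      fix F assume F: "F \<in> labellings R C V"
      hence "F \<in> extensional C" by (simp add: labellings_def)
      thus "(\<lambda>y\<in>C. \<psi> ((\<lambda>x\<in>C'. \<phi> (F (h x))) (h' y))) = F"
        using F by (intro extensionalityI[of _ C]) (auto simp: hC' V)
    qed
    show "\<forall>G\<in>labellings R' C' V'. (\<lambda>x\<in>C'. \<phi> ((\<lambda>y\<in>C. \<psi> (G (h' y))) (h x))) = G"
    proof
      fix G assume G: "G \<in> labellings R' C' V'"
      hence "G \<in> extensional C'" by (simp add: labellings_def)
      thus "(\<lambda>x\<in>C'. \<phi> ((\<lambda>y\<in>C. \<psi> (G (h' y))) (h x))) = G"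
        using G by (intro extensionalityI[of _ C']) (auto simp: hC V')
    qed
    show "(\<lambda>F. \<lambda>x\<in>C'. \<phi> (F (h x))) ` labellings R C V \<subseteq> labellings R' C' V'"
    proof safe
      fix F assume F: "F \<in> labellings R C V"
      hence "bij_betw F C V" by (simp add: labellings_def)
      hence "bij_betw (\<phi> \<circ> (F \<circ> h)) C' V'"
        using h \<phi>(1) by (blast intro: bij_betw_trans)
      hence "bij_betw (\<lambda>x\<in>C'. \<phi> (F (h x))) C' V'"
        by (subst bij_betw_cong[where g = "\<phi> \<circ> (F \<circ> h)"]) auto
      moreover have "F (h x) < F (h y)" if "x \<in> C'" "y \<in> C'" "R' x y" for x y
        using F that R hC by (auto simp: labellings_def)
      ultimately show "(\<lambda>x\<in>C'. \<phi> (F (h x))) \<in> labellings R' C' V'"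
        using F by (auto simp: labellings_def mono V[OF F] hC)
    qed
    show "(\<lambda>G. \<lambda>y\<in>C. \<psi> (G (h' y))) ` labellings R' C' V' \<subseteq> labellings R C V"
    proof safe
      fix G assume G: "G \<in> labellings R' C' V'"
      hence "bij_betw G C' V'" by (simp add: labellings_def)
      hence "bij_betw (\<psi> \<circ> (G \<circ> h')) C V"
        using h' \<psi>(1) by (blast intro: bij_betw_trans)
      hence "bij_betw (\<lambda>x\<in>C. \<psi> (G (h' x))) C V"
        by (subst bij_betw_cong[where g = "\<psi> \<circ> (G \<circ> h')"]) auto
      moreover have "G (h' x) < G (h' y)" if "x \<in> C" "y \<in> C" "R x y" for x y
      proof -
        have "R' (h' x) (h' y)" using that R[of "h' x" "h' y"] hC' by auto
        thus ?thesis using G that hC' by (auto simp: labellings_def)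
      qed
      ultimately show "(\<lambda>y\<in>C. \<psi> (G (h' y))) \<in> labellings R C V"
        using G by (auto simp: labellings_def mono' V'[OF G] hC')
    qed
  qed
qed

text \<open>
  The rank of \<open>v\<close> in \<open>V\<close>, counted from 1.  On a finite \<open>V\<close> this is the order isomorphism onto an
  initial segment of the positive integers that underlies reduction.
\<close>

definition rank :: "nat set \<Rightarrow> nat \<Rightarrow> nat" where
  "rank V v = card {e \<in> V. e \<le> v}"

lemma strict_mono_on_rank:
  assumes "finite V"
  shows "strict_mono_on V (rank V)"
proof (rule strict_mono_onI)
  fix a b assume "a \<in> V" "b \<in> V" "a < b"
  hence "{e \<in> V. e \<le> a} \<subset> {e \<in> V. e \<le> b}" by force
  thus "rank V a < rank V b" using assms by (simp add: rank_def psubset_card_mono)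
qed

lemma bij_betw_rank:
  assumes "finite V"
  shows "bij_betw (rank V) V {1..card V}"
proof -
  have inj: "inj_on (rank V) V"
    using strict_mono_on_rank[OF assms] by (rule strict_mono_on_imp_inj_on)
  have "rank V ` V \<subseteq> {1..card V}"
  proof safe
    fix v assume "v \<in> V"
    hence "{v} \<subseteq> {e \<in> V. e \<le> v}" by auto
    hence "card {v} \<le> rank V v"
      unfolding rank_def using assms by (intro card_mono) auto
    moreover have "rank V v \<le> card V"
      unfolding rank_def using assms by (intro card_mono) auto
    ultimately show "rank V v \<in> {1..card V}" by simp
  qed
  moreover have "card (rank V ` V) = card {1..card V}"
    using inj by (simp add: card_image)
  ultimately have "rank V ` V = {1..card V}" by (intro card_subset_eq) auto
  with inj show ?thesis by (simp add: bij_betw_def)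
qed

lemma card_labellings_rank:
  assumes "finite V"
  shows "card (labellings R C V) = card (labellings R C {1..card V})"
  by (rule bij_betw_same_card,
      rule bij_betw_labellings[where h = id, OF _ _ bij_betw_rank[OF assms] strict_mono_on_rank[OF assms]])
     auto

text \<open>
  The largest label sits on a maximal element; deleting that element leaves a labelling of the rest.
\<close>

lemma card_labellings_remove_max:
  assumes fin: "finite C" and card: "card C = Suc N"
  shows "card (labellings R C {1..Suc N}) =
         (\<Sum>x\<in>{x\<in>C. \<forall>y\<in>C. \<not> R x y}. card (labellings R (C - {x}) {1..N}))"
proof -
  let ?M = "{x\<in>C. \<forall>y\<in>C. \<not> R x y}"
  let ?L = "\<lambda>x. {F \<in> labellings R C {1..Suc N}. F x = Suc N}"
  have eq: "labellings R C {1..Suc N} = (\<Union>x\<in>?M. ?L x)"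
  proof safe
    fix F assume F: "F \<in> labellings R C {1..Suc N}"
    hence bij: "bij_betw F C {1..Suc N}" by (simp add: labellings_def)
    have "Suc N \<in> F ` C" using bij by (simp add: bij_betw_def)
    then obtain x where x: "x \<in> C" "F x = Suc N" by auto
    have "\<not> R x y" if "y \<in> C" for y
    proof
      assume "R x y"
      hence "F x < F y" using F x(1) that by (auto simp: labellings_def)
      moreover have "F y \<in> {1..Suc N}" using bij that by (auto simp: bij_betw_def)
      ultimately show False using x by simp
    qed
    thus "F \<in> (\<Union>x\<in>?M. ?L x)" using F x by blast
  qed
  have "card (\<Union>x\<in>?M. ?L x) = (\<Sum>x\<in>?M. card (?L x))"
  proof (rule card_UN_disjoint)
    show "\<forall>x\<in>?M. finite (?L x)" using finite_labellings[OF fin] by simp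
    show "\<forall>x\<in>?M. \<forall>y\<in>?M. x \<noteq> y \<longrightarrow> ?L x \<inter> ?L y = {}"
      by (auto simp: labellings_def bij_betw_def inj_on_def)
  qed (use fin in simp)
  also have "\<dots> = (\<Sum>x\<in>?M. card (labellings R (C - {x}) {1..N}))"
  proof (rule sum.cong[OF refl])
    fix x assume x: "x \<in> ?M"
    have ivl: "{1..Suc N} - {Suc N} = {1..N}" by auto
    have "bij_betw (\<lambda>F. restrict F (C - {x})) (?L x) (labellings R (C - {x}) {1..N})"
    proof (rule bij_betw_byWitness[where f' = "\<lambda>G. G(x := Suc N)"])
      show "\<forall>F\<in>?L x. (restrict F (C - {x}))(x := Suc N) = F"
        by (auto simp: labellings_def fun_eq_iff extensional_def)
      show "\<forall>G\<in>labellings R (C - {x}) {1..N}. restrict (G(x := Suc N)) (C - {x}) = G"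
        by (auto simp: labellings_def fun_eq_iff extensional_def)
      show "(\<lambda>F. restrict F (C - {x})) ` ?L x \<subseteq> labellings R (C - {x}) {1..N}"
      proof safe
        fix F assume F: "F \<in> labellings R C {1..Suc N}" "F x = Suc N"
        have "bij_betw F (C - {x}) ({1..Suc N} - {F x})"
          using F x by (intro bij_betw_DiffI) (auto simp: labellings_def bij_betw_def)
        hence "bij_betw F (C - {x}) {1..N}" unfolding F(2) ivl .
        thus "restrict F (C - {x}) \<in> labellings R (C - {x}) {1..N}"
          using F by (auto simp: labellings_def)
      qed
      show "(\<lambda>G. G(x := Suc N)) ` labellings R (C - {x}) {1..N} \<subseteq> ?L x"
      proof safe
        fix G assume G: "G \<in> labellings R (C - {x}) {1..N}"
        hence bij: "bij_betw G (C - {x}) {1..N}" by (simp add: labellings_def)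
        have "bij_betw (G(x := Suc N)) (C - {x}) {1..N}"
          using bij by (subst bij_betw_cong[where g = G]) auto
        moreover have "bij_betw (G(x := Suc N)) {x} {Suc N}" by (simp add: bij_betw_def)
        ultimately have "bij_betw (G(x := Suc N)) ((C - {x}) \<union> {x}) ({1..N} \<union> {Suc N})"
          by (rule bij_betw_combine) auto
        moreover have "(C - {x}) \<union> {x} = C" using x by auto
        moreover have "{1..N} \<union> {Suc N} = {1..Suc N}" by auto
        ultimately have b: "bij_betw (G(x := Suc N)) C {1..Suc N}" by simp
        have "G y < Suc N" if "y \<in> C" "y \<noteq> x" for y
          using bij_betw_apply[OF bij, of y] that by auto
        thus "G(x := Suc N) \<in> labellings R C {1..Suc N}"
          using G x b by (auto simp: labellings_def extensional_def)
      qed auto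
    qed
    thus "card (?L x) = card (labellings R (C - {x}) {1..N})" by (rule bij_betw_same_card)
  qed
  finally show ?thesis using eq by simp
qed

text \<open>
  A labelling of a disjoint union of two unrelated sets amounts to a choice of the set \<open>S\<close> of labels
  used on the first one, and a labelling of each part.
\<close>

lemma sum_labellings_Un:
  fixes w :: "('a \<Rightarrow> nat) \<Rightarrow> 'b::comm_semiring_1"
  assumes fin: "finite C1" "finite C2" "finite V" and disj: "C1 \<inter> C2 = {}"
    and R: "\<And>x y. x \<in> C1 \<Longrightarrow> y \<in> C2 \<Longrightarrow> \<not> R x y \<and> \<not> R y x"
  shows "(\<Sum>F\<in>labellings R (C1 \<union> C2) V. w (restrict F C2)) =
    (\<Sum>S\<in>{S. S \<subseteq> V \<and> card S = card C1}.
       of_nat (card (labellings R C1 S)) * (\<Sum>G\<in>labellings R C2 (V - S). w G))"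
proof -
  let ?S = "{S. S \<subseteq> V \<and> card S = card C1}"
  let ?P = "\<lambda>S. labellings R C1 S \<times> labellings R C2 (V - S)"
  have finS: "finite S" if "S \<in> ?S" for S using that fin finite_subset by auto
  have "(\<Sum>F\<in>labellings R (C1 \<union> C2) V. w (restrict F C2)) =
        (\<Sum>(S, G1, G2)\<in>Sigma ?S ?P. w G2)"
  proof (rule sum.reindex_bij_witness[where
        i = "\<lambda>(S, G1, G2). (\<lambda>x. if x \<in> C1 then G1 x else G2 x)" and
        j = "\<lambda>F. (F ` C1, restrict F C1, restrict F C2)"])
    fix F assume F: "F \<in> labellings R (C1 \<union> C2) V"
    hence bij: "bij_betw F (C1 \<union> C2) V" by (simp add: labellings_def)
    show "(case (F ` C1, restrict F C1, restrict F C2) of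
            (S, G1, G2) \<Rightarrow> (\<lambda>x. if x \<in> C1 then G1 x else G2 x)) = F"
      using F by (auto simp: labellings_def fun_eq_iff extensional_def)
    have inj: "inj_on F C1" "inj_on F C2"
      using bij inj_on_subset by (auto simp: bij_betw_def)
    have im: "F ` C2 = V - F ` C1"
    proof -
      have "F ` ((C1 \<union> C2) - C1) = F ` (C1 \<union> C2) - F ` C1"
        using bij by (intro inj_on_image_set_diff[of F "C1 \<union> C2"]) (auto simp: bij_betw_def)
      moreover have "(C1 \<union> C2) - C1 = C2" using disj by auto
      ultimately show ?thesis using bij by (simp add: bij_betw_def)
    qed
    have "F ` C1 \<subseteq> V" using bij by (auto simp: bij_betw_def)
    moreover have "restrict F C1 \<in> labellings R C1 (F ` C1)"
      using F inj(1) by (simp add: labellings_def bij_betw_def)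
    moreover have "restrict F C2 \<in> labellings R C2 (V - F ` C1)"
      using F inj(2) im by (simp add: labellings_def bij_betw_def)
    ultimately show "(F ` C1, restrict F C1, restrict F C2) \<in> Sigma ?S ?P"
      using inj by (simp add: card_image)
    show "(case (F ` C1, restrict F C1, restrict F C2) of (S, G1, G2) \<Rightarrow> w G2) = w (restrict F C2)"
      by simp
  next
    fix t assume t: "t \<in> Sigma ?S ?P"
    obtain S G1 G2 where [simp]: "t = (S, G1, G2)" by (cases t) auto
    let ?F = "\<lambda>x. if x \<in> C1 then G1 x else G2 x"
    have S: "S \<subseteq> V" and G: "G1 \<in> labellings R C1 S" "G2 \<in> labellings R C2 (V - S)"
      using t by auto
    have b1: "bij_betw G1 C1 S" and b2: "bij_betw G2 C2 (V - S)"
      using G by (auto simp: labellings_def)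
    have "bij_betw ?F C1 S"
      using b1 by (subst bij_betw_cong[where g = G1]) auto
    moreover have "bij_betw ?F C2 (V - S)"
      using b2 disj by (subst bij_betw_cong[where g = G2]) auto
    ultimately have "bij_betw ?F (C1 \<union> C2) (S \<union> (V - S))"
      by (rule bij_betw_combine) auto
    moreover have "S \<union> (V - S) = V" using S by auto
    ultimately have "bij_betw ?F (C1 \<union> C2) V" by simp
    thus "(case t of (S, G1, G2) \<Rightarrow> (\<lambda>x. if x \<in> C1 then G1 x else G2 x))
            \<in> labellings R (C1 \<union> C2) V"
      using G R disj by (auto simp: labellings_def extensional_def)
    have "G1 ` C1 = S" using b1 by (simp add: bij_betw_def)
    moreover have "restrict ?F C1 = G1" "restrict ?F C2 = G2"
      using G disj by (force simp: labellings_def fun_eq_iff extensional_def)+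
    moreover have "?F ` C1 = G1 ` C1" by (rule image_cong) auto
    ultimately show "(\<lambda>F. (F ` C1, restrict F C1, restrict F C2))
        (case t of (S, G1, G2) \<Rightarrow> (\<lambda>x. if x \<in> C1 then G1 x else G2 x)) = t"
      by simp
  qed
  also have "\<dots> = (\<Sum>S\<in>?S. \<Sum>(G1, G2)\<in>?P S. w G2)"
  proof (rule sum.Sigma [symmetric])
    show "finite ?S" using fin(3) by simp
    show "\<forall>S\<in>?S. finite (?P S)"
      using fin finS by (blast intro: finite_cartesian_product finite_labellings finite_Diff)
  qed
  also have "\<dots> = (\<Sum>S\<in>?S. of_nat (card (labellings R C1 S)) * (\<Sum>G\<in>labellings R C2 (V - S). w G))"
    by (simp add: sum.cartesian_product [symmetric])
  finally show ?thesis .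
qed

section \<open>A determinant with reciprocal factorials\<close>

text \<open>
  The reciprocal factorial of an integer.  Setting it to \<open>0\<close> at negative integers makes the rule
  \<open>1/(z - 1)! = z/z!\<close> hold everywhere, in particular at \<open>z = 0\<close>.
\<close>

definition inv_fact :: "int \<Rightarrow> 'a::field_char_0" where
  "inv_fact z = (if z < 0 then 0 else inverse (fact (nat z)))"

lemma inv_fact_pred: "inv_fact (z - 1) = of_int z * (inv_fact z :: 'a::field_char_0)"
proof (cases "z > 0")
  case True
  then obtain m where z: "z = int (Suc m)" using zero_less_imp_eq_int gr0_implies_Suc by blast
  have "inv_fact (int (Suc m) - 1) = (inverse (fact m) :: 'a)" "inv_fact (int (Suc m)) = (inverse (fact (Suc m)) :: 'a)"
    by (simp_all add: inv_fact_def nat_add_distrib)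
  moreover have "inverse (fact m) = of_nat (Suc m) * (inverse (fact (Suc m)) :: 'a)"
    by (simp add: field_simps del: of_nat_Suc)
  ultimately show ?thesis by (simp only: z of_int_of_nat_eq)
next
  case False
  thus ?thesis by (cases "z = 0") (auto simp: inv_fact_def)
qed

text \<open>
  The matrix with entries \<open>1/(\<mu>\<^sub>i - i + j)!\<close> for \<open>0 \<le> i, j < k\<close>, whose determinant occurs in Aitken's
  formula for the number of standard tableaux.  The parameters are integers, because lowering a
  zero part of a partition must make sense.
\<close>

definition aitken_mat :: "nat \<Rightarrow> (nat \<Rightarrow> int) \<Rightarrow> 'a::field_char_0 mat" where
  "aitken_mat k \<mu> = mat k k (\<lambda>(i, j). inv_fact (\<mu> i - int i + int j))"

lemma aitken_mat_carrier [simp]: "aitken_mat k \<mu> \<in> carrier_mat k k"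
  by (simp add: aitken_mat_def)

lemma index_aitken_mat [simp]:
  "i < k \<Longrightarrow> j < k \<Longrightarrow> aitken_mat k \<mu> $$ (i, j) = inv_fact (\<mu> i - int i + int j)"
  by (simp add: aitken_mat_def)

text \<open>
  Lowering \<open>\<mu>\<^sub>i\<close> by one multiplies the entry \<open>(i, j)\<close> by \<open>\<mu>\<^sub>i - i + j\<close> and leaves the other rows alone.  In
  the Leibniz expansion the term of the permutation \<open>p\<close> is thus multiplied in total by
  \<open>\<Sum>\<^sub>i (\<mu>\<^sub>i - i + p(i))\<close>, which is \<open>\<Sum>\<^sub>i \<mu>\<^sub>i\<close> for every \<open>p\<close>.
\<close>

lemma sum_det_aitken_mat:
  "(\<Sum>i<k. det (aitken_mat k (\<mu>(i := \<mu> i - 1)))) =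
     of_int (\<Sum>i<k. \<mu> i) * (det (aitken_mat k \<mu>) :: 'a::field_char_0)"
proof -
  let ?A = "aitken_mat k \<mu> :: 'a mat"
  let ?P = "{p. p permutes {0..<k}}"
  let ?w = "\<lambda>i p. of_int (\<mu> i - int i + int (p i)) :: 'a"
  have row: "(\<Prod>l=0..<k. aitken_mat k (\<mu>(i := \<mu> i - 1)) $$ (l, p l)) =
             ?w i p * (\<Prod>l=0..<k. ?A $$ (l, p l))" if i: "i < k" and p: "p \<in> ?P" for i p
  proof -
    have pl: "p l < k" if "l < k" for l using p that permutes_in_image[of p "{0..<k}" l] by auto
    have "(\<Prod>l=0..<k. aitken_mat k (\<mu>(i := \<mu> i - 1)) $$ (l, p l)) =
          (\<Prod>l=0..<k. (if l = i then ?w i p else 1) * ?A $$ (l, p l))"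
    proof (rule prod.cong[OF refl])
      fix l assume "l \<in> {0..<k}"
      moreover have "inv_fact (\<mu> i - 1 - int i + int (p i)) =
          ?w i p * inv_fact (\<mu> i - int i + int (p i))"
      proof -
        have "\<mu> i - 1 - int i + int (p i) = \<mu> i - int i + int (p i) - 1" by simp
        thus ?thesis by (simp only: inv_fact_pred)
      qed
      ultimately show "aitken_mat k (\<mu>(i := \<mu> i - 1)) $$ (l, p l) =
          (if l = i then ?w i p else 1) * ?A $$ (l, p l)"
        using pl by (auto simp del: of_int_add of_int_diff)
    qed
    thus ?thesis using i by (simp add: prod.distrib)
  qed
  have total: "(\<Sum>i<k. ?w i p) = of_int (\<Sum>i<k. \<mu> i)" if p: "p \<in> ?P" for p
  proof -
    have "(\<Sum>i<k. int (p i)) = (\<Sum>i<k. int i)"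
      using p sum.permute[of p "{..<k}" int] by (simp add: o_def atLeast0LessThan)
    hence "(\<Sum>i<k. \<mu> i - int i + int (p i)) = (\<Sum>i<k. \<mu> i)"
      by (simp add: sum.distrib sum_subtractf)
    thus ?thesis by (metis of_int_sum)
  qed
  have "(\<Sum>i<k. det (aitken_mat k (\<mu>(i := \<mu> i - 1)))) =
        (\<Sum>i<k. \<Sum>p\<in>?P. signof p * (?w i p * (\<Prod>l=0..<k. ?A $$ (l, p l))))"
    unfolding det_def'[OF aitken_mat_carrier]
    by (intro sum.cong refl arg_cong2[where f = "(*)"] row) auto
  also have "\<dots> = (\<Sum>p\<in>?P. \<Sum>i<k. signof p * (?w i p * (\<Prod>l=0..<k. ?A $$ (l, p l))))"
    by (rule sum.swap)
  also have "\<dots> = (\<Sum>p\<in>?P. (\<Sum>i<k. ?w i p) * (signof p * (\<Prod>l=0..<k. ?A $$ (l, p l))))"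
    unfolding sum_distrib_right by (intro sum.cong refl) (rule mult.left_commute)
  also have "\<dots> = (\<Sum>p\<in>?P. of_int (\<Sum>i<k. \<mu> i) * (signof p * (\<Prod>l=0..<k. ?A $$ (l, p l))))"
    by (intro sum.cong refl) (simp only: total)
  also have "\<dots> = of_int (\<Sum>i<k. \<mu> i) * det ?A"
    by (simp only: sum_distrib_left det_def'[OF aitken_mat_carrier])
  finally show ?thesis .
qed

lemma det_aitken_mat_eq_0_adjacent:
  assumes "Suc i < k" "\<mu> (Suc i) = \<mu> i + 1"
  shows "det (aitken_mat k \<mu>) = (0 :: 'a::field_char_0)"
proof (rule det_identical_rows[of _ k i "Suc i"])
  show "row (aitken_mat k \<mu>) i = (row (aitken_mat k \<mu>) (Suc i) :: 'a vec)"
    using assms by (intro eq_vecI) (auto simp: aitken_mat_def)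
qed (use assms in auto)

lemma det_aitken_mat_eq_0_last:
  assumes "k > 0" "\<mu> (k - 1) = - 1"
  shows "det (aitken_mat k \<mu>) = (0 :: 'a::field_char_0)"
proof -
  have "(\<Prod>l=0..<k. aitken_mat k \<mu> $$ (l, p l)) = (0::'a)" if "p permutes {0..<k}" for p
  proof (rule prod_zero)
    have "p (k - 1) < k" using permutes_in_image[OF that, of "k - 1"] assms(1) by auto
    hence "aitken_mat k \<mu> $$ (k - 1, p (k - 1)) = (0::'a)"
      using assms by (simp add: inv_fact_def)
    thus "\<exists>l\<in>{0..<k}. aitken_mat k \<mu> $$ (l, p l) = (0::'a)"
      using assms(1) by (intro bexI[of _ "k - 1"]) auto
  qed simp
  thus ?thesis
    unfolding det_def'[OF aitken_mat_carrier]
    by (intro sum.neutral ballI) (simp only: mem_Collect_eq mult_zero_right)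
qed

lemma det_aitken_mat_0: "det (aitken_mat k (\<lambda>_. 0)) = (1 :: 'a::field_char_0)"
proof -
  have "det (aitken_mat k (\<lambda>_. 0) :: 'a mat) = prod_list (diag_mat (aitken_mat k (\<lambda>_. 0)))"
    by (rule det_upper_triangular[of _ k])
       (auto simp: upper_triangular_def aitken_mat_def inv_fact_def)
  also have "\<dots> = 1"
    by (simp add: prod_list_diag_prod inv_fact_def aitken_mat_def)
  finally show ?thesis .
qed

lemma det_aitken_mat_cong:
  assumes "\<And>i. i < k \<Longrightarrow> \<mu> i = \<mu>' i"
  shows "det (aitken_mat k \<mu>) = (det (aitken_mat k \<mu>') :: 'a::field_char_0)"
proof -
  have "aitken_mat k \<mu> = (aitken_mat k \<mu>' :: 'a mat)"
    by (rule eq_matI) (auto simp: aitken_mat_def assms)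
  thus ?thesis by simp
qed

text \<open>
  The entries for a rectangle are \<open>i! / (n + j)!\<close> times the binomial coefficient of \<open>n + j\<close> over \<open>i\<close>;
  Vandermonde's convolution then factors the matrix into a lower and an upper triangular one.
\<close>

lemma det_aitken_mat_const:
  "det (aitken_mat k (\<lambda>_. int n)) = (\<Prod>i<k. fact i / fact (n + i) :: 'a::field_char_0)"
proof -
  define L :: "'a mat" where
    "L = mat k k (\<lambda>(i, s). if s \<le> i then fact i * of_nat (n choose (i - s)) else 0)"
  define U :: "'a mat" where "U = mat k k (\<lambda>(s, j). of_nat (j choose s) / fact (n + j))"
  have L: "L \<in> carrier_mat k k" and U: "U \<in> carrier_mat k k" by (auto simp: L_def U_def)
  have "aitken_mat k (\<lambda>_. int n) = L * U"
  proof (rule eq_matI)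
    fix i j assume "i < dim_row (L * U)" "j < dim_col (L * U)"
    hence ij: "i < k" "j < k" by (auto simp: L_def U_def)
    have "(L * U) $$ (i, j) = (\<Sum>s<k. L $$ (i, s) * U $$ (s, j))"
      using ij L U by (simp add: scalar_prod_def atLeast0LessThan)
    also have "\<dots> = (\<Sum>s<k. if s \<le> i then
        fact i / fact (n + j) * of_nat ((j choose s) * (n choose (i - s))) else 0)"
      using ij by (intro sum.cong) (auto simp: L_def U_def)
    also have "\<dots> = (\<Sum>s\<le>i. fact i / fact (n + j) * of_nat ((j choose s) * (n choose (i - s))))"
      using ij by (intro sum.mono_neutral_cong_right) auto
    also have "\<dots> = fact i / fact (n + j) * of_nat ((n + j) choose i)"
      by (simp only: sum_distrib_left [symmetric] of_nat_sum [symmetric] vandermonde add.commute)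
    also have "\<dots> = inv_fact (int n - int i + int j)"
    proof (cases "i \<le> n + j")
      case True
      have "nat (int n - int i + int j) = n + j - i" using True by simp
      thus ?thesis using True by (simp add: inv_fact_def binomial_fact field_simps)
    next
      case False
      thus ?thesis by (simp add: inv_fact_def binomial_eq_0)
    qed
    finally show "aitken_mat k (\<lambda>_. int n) $$ (i, j) = (L * U) $$ (i, j)"
      using ij by simp
  qed (auto simp: L_def U_def aitken_mat_def)
  hence "det (aitken_mat k (\<lambda>_. int n)) = det L * det U"
    using det_mult[OF L U] by simp
  also have "det L = (\<Prod>i<k. fact i)"
    using det_lower_triangular[OF _ L] by (simp add: prod_list_diag_prod L_def atLeast0LessThan)
  also have "det U = (\<Prod>i<k. 1 / fact (n + i))"
    using det_upper_triangular[OF _ U]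
    by (simp add: prod_list_diag_prod U_def upper_triangular_def atLeast0LessThan binomial_eq_0)
  finally show ?thesis by (simp flip: prod.distrib)
qed

section \<open>Counting standard tableaux\<close>

text \<open>
  The Young diagram with rows of lengths \<open>lam 1, \<dots>, lam k\<close>, counted from the bottom.
\<close>

definition diagram :: "nat \<Rightarrow> (nat \<Rightarrow> nat) \<Rightarrow> (nat \<times> nat) set" where
  "diagram k lam = Sigma {1..k} (\<lambda>r. {1..lam r})"

text \<open>
  The inequalities defining a standard tableau: columns increase, and each entry is smaller than
  its right neighbour.
\<close>

definition tab_rel :: "nat \<times> nat \<Rightarrow> nat \<times> nat \<Rightarrow> bool" where
  "tab_rel p q \<longleftrightarrow> snd p = snd q \<and> fst p < fst q \<or> fst p = fst q \<and> snd q = Suc (snd p)"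

lemma maximal_diagram:
  assumes anti: "\<And>r. 1 \<le> r \<Longrightarrow> r < k \<Longrightarrow> lam (Suc r) \<le> lam r"
  shows "{p\<in>diagram k lam. \<forall>q\<in>diagram k lam. \<not> tab_rel p q} =
         (\<lambda>r. (r, lam r)) ` {r\<in>{1..k}. 0 < lam r \<and> (r < k \<longrightarrow> lam (Suc r) < lam r)}"
    (is "?A = ?B")
proof (rule antisym)
  show "?A \<subseteq> ?B"
  proof
    fix p assume p: "p \<in> ?A"
    obtain r c where [simp]: "p = (r, c)" by (cases p) auto
    have rc: "1 \<le> r" "r \<le> k" "1 \<le> c" "c \<le> lam r"
      using p by (auto simp: diagram_def)
    have max: "\<not> tab_rel p q" if "q \<in> diagram k lam" for q using p that by auto
    have "c = lam r"
      using max[of "(r, Suc c)"] rc by (force simp: diagram_def tab_rel_def)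
    moreover have "lam (Suc r) < lam r" if "r < k"
      using max[of "(Suc r, c)"] rc that \<open>c = lam r\<close> by (force simp: diagram_def tab_rel_def)
    ultimately show "p \<in> ?B" using rc by auto
  qed
  show "?B \<subseteq> ?A"
  proof
    fix p assume "p \<in> ?B"
    then obtain r where p: "p = (r, lam r)"
      and r: "r \<in> {1..k}" "0 < lam r" "r < k \<longrightarrow> lam (Suc r) < lam r" by blast
    have "\<not> tab_rel p (r', c')" if q: "(r', c') \<in> diagram k lam" for r' c'
    proof
      assume "tab_rel p (r', c')"
      hence r': "r < r'" "r' \<le> k" "lam r \<le> lam r'"
        using q by (auto simp: p diagram_def tab_rel_def)
      have "Suc r \<le> r'" using r' by simp
      hence "lam r' \<le> lam (Suc r)"
        using r'(2)
      proof (induction r' rule: dec_induct)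
        case (step s)
        thus ?case using anti[of s] by simp
      qed simp
      thus False using r r' by simp
    qed
    thus "p \<in> ?A" using r by (auto simp: p diagram_def)
  qed
qed

text \<open>
  Aitken's determinantal formula.  The number of tableaux satisfies the recurrence that sums over
  the removal of a corner, and so does \<open>N!\<close> times the determinant: its recurrence sums over all rows,
  but lowering a row without a corner gives a vanishing determinant.
\<close>

lemma card_labellings_diagram:
  assumes "\<And>r. 1 \<le> r \<Longrightarrow> r < k \<Longrightarrow> lam (Suc r) \<le> lam r" and "(\<Sum>r=1..k. lam r) = N"
  shows "of_nat (card (labellings tab_rel (diagram k lam) {1..N})) =
         fact N * (det (aitken_mat k (\<lambda>i. int (lam (Suc i)))) :: 'a::field_char_0)"
  using assms
proof (induction N arbitrary: lam)
  case 0
  hence lam: "lam r = 0" if "1 \<le> r" "r \<le> k" for r using that by auto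
  hence "diagram k lam = {}" by (auto simp: diagram_def)
  moreover have "det (aitken_mat k (\<lambda>i. int (lam (Suc i)))) = (1 :: 'a)"
    by (subst det_aitken_mat_cong[of k _ "\<lambda>_. 0"]) (auto simp: lam det_aitken_mat_0)
  ultimately show ?case by (simp add: labellings_empty)
next
  case (Suc N lam)
  define \<mu> where "\<mu> = (\<lambda>i. int (lam (Suc i)))"
  let ?corner = "{r\<in>{1..k}. 0 < lam r \<and> (r < k \<longrightarrow> lam (Suc r) < lam r)}"
  let ?d = "\<lambda>r. det (aitken_mat k (\<mu>(r - 1 := \<mu> (r - 1) - 1))) :: 'a"
  have fin: "finite (diagram k lam)" by (simp add: diagram_def)
  have card: "card (diagram k lam) = Suc N" using Suc.prems(2) by (simp add: diagram_def)
  have max: "{p\<in>diagram k lam. \<forall>q\<in>diagram k lam. \<not> tab_rel p q} = (\<lambda>r. (r, lam r)) ` ?corner"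
    by (rule maximal_diagram) (rule Suc.prems(1))
  have "of_nat (card (labellings tab_rel (diagram k lam) {1..Suc N})) =
        (\<Sum>r\<in>?corner. of_nat (card (labellings tab_rel (diagram k lam - {(r, lam r)}) {1..N})) :: 'a)"
    unfolding card_labellings_remove_max[OF fin card] max
    by (subst sum.reindex) (auto simp: inj_on_def)
  also have "\<dots> = (\<Sum>r\<in>?corner. fact N * ?d r)"
  proof (rule sum.cong[OF refl])
    fix r assume r: "r \<in> ?corner"
    let ?lam = "lam(r := lam r - 1)"
    have diff: "diagram k lam - {(r, lam r)} = diagram k ?lam"
      using r by (auto simp: diagram_def split: if_splits)
    have "(\<Sum>s=1..k. lam s) = lam r + (\<Sum>s\<in>{1..k}-{r}. lam s)"
      using r by (intro sum.remove) auto
    moreover have "(\<Sum>s=1..k. ?lam s) = ?lam r + (\<Sum>s\<in>{1..k}-{r}. ?lam s)"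
      using r by (intro sum.remove) auto
    moreover have "(\<Sum>s\<in>{1..k}-{r}. ?lam s) = (\<Sum>s\<in>{1..k}-{r}. lam s)"
      by (intro sum.cong) auto
    ultimately have sum: "(\<Sum>s=1..k. ?lam s) = N" using r Suc.prems(2) by simp
    have anti: "?lam (Suc s) \<le> ?lam s" if "1 \<le> s" "s < k" for s
      using Suc.prems(1)[OF that] r that by auto
    have "of_nat (card (labellings tab_rel (diagram k ?lam) {1..N})) =
          fact N * (det (aitken_mat k (\<lambda>i. int (?lam (Suc i)))) :: 'a)"
      by (rule Suc.IH[OF anti sum])
    also have "det (aitken_mat k (\<lambda>i. int (?lam (Suc i)))) = ?d r"
      using r by (intro det_aitken_mat_cong) (auto simp: \<mu>_def of_nat_diff)
    finally show "of_nat (card (labellings tab_rel (diagram k lam - {(r, lam r)}) {1..N})) = fact N * ?d r"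
      unfolding diff .
  qed
  also have "\<dots> = (\<Sum>r=1..k. fact N * ?d r)"
  proof (rule sum.mono_neutral_left)
    show "\<forall>r\<in>{1..k} - ?corner. fact N * ?d r = 0"
    proof
      fix r assume "r \<in> {1..k} - ?corner"
      hence r: "1 \<le> r" "r \<le> k" and n: "lam r = 0 \<or> r < k \<and> lam r \<le> lam (Suc r)" by auto
      have "?d r = 0"
      proof (cases "r < k")
        case True
        hence "lam (Suc r) = lam r" using Suc.prems(1)[of r] r n by auto
        thus ?thesis
          using True r by (intro det_aitken_mat_eq_0_adjacent[of "r - 1"]) (auto simp: \<mu>_def)
      next
        case False
        thus ?thesis using r n by (intro det_aitken_mat_eq_0_last) (auto simp: \<mu>_def)
      qed
      thus "fact N * ?d r = 0" by simp
    qed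
  qed auto
  also have "\<dots> = fact N * (\<Sum>i<k. det (aitken_mat k (\<mu>(i := \<mu> i - 1))))"
    unfolding sum_distrib_left
    by (rule sum.reindex_bij_witness[of _ Suc "\<lambda>r. r - 1"]) auto
  also have "\<dots> = fact N * (of_int (\<Sum>i<k. \<mu> i) * det (aitken_mat k \<mu>))"
    by (simp only: sum_det_aitken_mat)
  also have "(\<Sum>i<k. \<mu> i) = int (\<Sum>r=1..k. lam r)"
    unfolding \<mu>_def of_nat_sum
    by (rule sum.reindex_bij_witness[of _ "\<lambda>r. r - 1" Suc]) auto
  also have "(\<Sum>r=1..k. lam r) = Suc N" by (rule Suc.prems(2))
  finally show ?case by (simp add: \<mu>_def algebra_simps)
qed

lemma card_labellings_rectangle:
  "of_nat (card (labellings tab_rel (cells n k) {1..k * n})) =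
     (fact (k * n) * (\<Prod>i<k. fact i / fact (n + i)) :: 'a::field_char_0)"
proof -
  have "cells n k = diagram k (\<lambda>_. n)" by (auto simp: cells_def diagram_def)
  thus ?thesis
    using card_labellings_diagram[of k "\<lambda>_. n" "k * n", where ?'a = 'a]
    by (simp add: det_aitken_mat_const)
qed

section \<open>Fillings, matches and initial runs\<close>

text \<open>
  The inequalities that define \<^const>\<open>fillings\<close>: every column increases from bottom to top.
\<close>

definition col_rel :: "nat \<times> nat \<Rightarrow> nat \<times> nat \<Rightarrow> bool" where
  "col_rel p q \<longleftrightarrow> snd p = snd q \<and> fst p < fst q"

lemma fillings_eq_labellings: "fillings n k = labellings col_rel (cells n k) {1..k * n}"
  by (auto simp: fillings_def labellings_def cells_def col_rel_def)

text \<open>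
  All rows ascend from column \<open>i\<close> to column \<open>i + 1\<close>, i.e. a filling \<open>F\<close> has a match with the
  set of standard tableaux of two columns at position \<open>i\<close>.
\<close>

definition ascends :: "nat \<Rightarrow> (nat \<times> nat \<Rightarrow> nat) \<Rightarrow> nat \<Rightarrow> bool" where
  "ascends k F i \<longleftrightarrow> (\<forall>r\<in>{1..k}. F (r, i) < F (r, Suc i))"

lemma red_two_cols_standard_iff:
  assumes F: "F \<in> fillings n k" and i: "1 \<le> i" "i < n"
  shows "red 2 k (two_cols k F i) \<in> standard_tableaux 2 k \<longleftrightarrow> ascends k F i"
proof -
  let ?C = "cells 2 k" and ?G = "two_cols k F i"
  let ?V = "?G ` ?C"
  have G: "?G (r, c) = F (r, i + c - 1)" if "(r, c) \<in> ?C" for r c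
    using that by (simp add: two_cols_def)
  have inj: "inj_on ?G ?C"
  proof (rule inj_onI)
    fix p q assume pq: "p \<in> ?C" "q \<in> ?C" "?G p = ?G q"
    obtain r c r' c' where [simp]: "p = (r, c)" "q = (r', c')" by (cases p, cases q) auto
    have "inj_on F (cells n k)" using F by (auto simp: fillings_def bij_betw_def)
    moreover have "(r, i + c - 1) \<in> cells n k" "(r', i + c' - 1) \<in> cells n k"
      using pq i by (auto simp: cells_def)
    moreover have "F (r, i + c - 1) = F (r', i + c' - 1)" using pq G by simp
    ultimately have "(r, i + c - 1) = (r', i + c' - 1)" by (meson inj_onD)
    thus "p = q" using i by auto
  qed
  have "?G (r, c) < ?G (r', c)" if "(r, c) \<in> ?C" "(r', c) \<in> ?C" "r < r'" for r r' c
  proof -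
    have "i + c - 1 \<in> {1..n}" "r \<in> {1..k}" "r' \<in> {1..k}" using that i by (auto simp: cells_def)
    thus ?thesis using F that unfolding G[OF that(1)] G[OF that(2)] fillings_def by blast
  qed
  hence "?G \<in> labellings col_rel ?C ?V"
    using inj by (auto simp: labellings_def bij_betw_def col_rel_def two_cols_def)
  moreover have fin: "finite ?V" by (simp add: cells_def)
  hence "bij_betw (\<lambda>H. \<lambda>p\<in>?C. rank ?V (H (id p)))
           (labellings col_rel ?C ?V) (labellings col_rel ?C {1..card ?V})"
    by (intro bij_betw_labellings bij_betw_rank strict_mono_on_rank) (auto simp: bij_betw_def)
  ultimately have "(\<lambda>p\<in>?C. rank ?V (?G (id p))) \<in> labellings col_rel ?C {1..card ?V}"
    by (rule bij_betw_apply[rotated])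
  moreover have "card ?V = k * 2" using inj by (simp add: card_image cells_def)
  moreover have red: "(\<lambda>p\<in>?C. rank ?V (?G (id p))) = red 2 k ?G"
    by (simp add: red_def rank_def)
  ultimately have fill: "red 2 k ?G \<in> fillings 2 k" by (simp add: fillings_eq_labellings)
  have less: "red 2 k ?G (r, 1) < red 2 k ?G (r, 2) \<longleftrightarrow> F (r, i) < F (r, Suc i)"
    if r: "r \<in> {1..k}" for r
  proof -
    have C: "(r, 1) \<in> ?C" "(r, 2) \<in> ?C" using r by (auto simp: cells_def)
    have "rank ?V (?G (r, 1)) < rank ?V (?G (r, 2)) \<longleftrightarrow> ?G (r, 1) < ?G (r, 2)"
      using C by (intro strict_mono_on_less[OF strict_mono_on_rank[OF fin]]) auto
    thus ?thesis using C i by (simp add: G flip: red)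
  qed
  have two: "{1..2} = {1, 2 :: nat}" by auto
  have "red 2 k ?G \<in> standard_tableaux 2 k \<longleftrightarrow>
        (\<forall>r\<in>{1..k}. red 2 k ?G (r, 1) < red 2 k ?G (r, 2))"
    unfolding standard_tableaux_def two using fill by auto
  thus ?thesis unfolding ascends_def using less by blast
qed

lemma mch_standard_eq:
  assumes "F \<in> fillings n k"
  shows "mch k (standard_tableaux 2 k) n F = card {i \<in> {1..<n}. ascends k F i}"
proof -
  have "{i \<in> {1..<n}. red 2 k (two_cols k F i) \<in> standard_tableaux 2 k} =
        {i \<in> {1..<n}. ascends k F i}"
    using red_two_cols_standard_iff[OF assms] by auto
  thus ?thesis by (simp add: mch_def)
qed

text \<open>
  The summand for \<open>m\<close> is present when the positions before \<open>m\<close> all satisfy \<open>P\<close>; the position \<open>m\<close>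
  itself is then left out of account.  The identity arises by splitting the weight of a position as
  \<open>x\<^bsup>[P]\<^esup> = 1 + [P] (x - 1)\<close> from left to right, as long as the second summand is chosen.
\<close>

lemma power_card_eq_sum_initial_run:
  fixes x :: "'a::comm_ring_1"
  assumes "n \<ge> 1"
  shows "x ^ card {i \<in> {1..<n}. P i} =
         (\<Sum>m=1..n. if \<forall>i\<in>{1..<m}. P i
                   then (x - 1) ^ (m - 1) * x ^ card {i \<in> {Suc m..<n}. P i} else 0)"
proof -
  define W where "W m = x ^ card {i \<in> {m..<n}. P i}" for m
  define A where "A m \<longleftrightarrow> (\<forall>i\<in>{1..<m}. P i)" for m
  have W_step: "W m = W (Suc m) + (if P m then (x - 1) * W (Suc m) else 0)" if "m < n" for m
  proof -
    have "{i \<in> {m..<n}. P i} =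
          (if P m then insert m {i \<in> {Suc m..<n}. P i} else {i \<in> {Suc m..<n}. P i})"
      using that by (auto simp: Suc_le_eq le_less)
    thus ?thesis by (simp add: W_def algebra_simps)
  qed
  have A_step: "A (Suc (Suc j)) \<longleftrightarrow> A (Suc j) \<and> P (Suc j)" for j
    by (auto simp: A_def less_Suc_eq)
  \<comment> \<open>Once \<open>j\<close> positions are split, only the branch where all of them are matches is left to expand.\<close>
  have "W 1 = (\<Sum>m=1..j. if A m then (x - 1) ^ (m - 1) * W (Suc m) else 0) +
              (if A (Suc j) then (x - 1) ^ j * W (Suc j) else 0)" if "j < n" for j
    using that
  proof (induction j)
    case 0
    show ?case by (simp add: A_def)
  next
    case (Suc j)
    thus ?case using W_step[of "Suc j"] by (simp add: A_step algebra_simps)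
  qed
  from this[of "n - 1"] have "W 1 = (\<Sum>m=1..n-1. if A m then (x - 1) ^ (m - 1) * W (Suc m) else 0) +
              (if A n then (x - 1) ^ (n - 1) * W n else 0)" using assms by simp
  \<comment> \<open>Both sets of positions are empty, so the remaining term is the summand for \<open>m = n\<close>.\<close>
  moreover have "W n = W (Suc n)" by (simp add: W_def)
  moreover have "{1..n} = insert n {1..n-1}" using assms by auto
  ultimately have "W 1 = (\<Sum>m=1..n. if A m then (x - 1) ^ (m - 1) * W (Suc m) else 0)"
    using assms by (simp add: add.commute)
  thus ?thesis by (simp only: W_def A_def)
qed

text \<open>
  Columns increase, and in addition the rows increase among the first \<open>m\<close> columns.
\<close>

definition initial_rel :: "nat \<Rightarrow> nat \<times> nat \<Rightarrow> nat \<times> nat \<Rightarrow> bool" where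
  "initial_rel m p q \<longleftrightarrow> col_rel p q \<or> fst p = fst q \<and> snd q = Suc (snd p) \<and> snd q \<le> m"

lemma fillings_initial_ascents:
  assumes "m \<le> n"
  shows "{F \<in> fillings n k. \<forall>i\<in>{1..<m}. ascends k F i} =
         labellings (initial_rel m) (cells n k) {1..k * n}"
proof (rule antisym)
  show "{F \<in> fillings n k. \<forall>i\<in>{1..<m}. ascends k F i} \<subseteq> labellings (initial_rel m) (cells n k) {1..k * n}"
    by (auto simp: fillings_eq_labellings labellings_def initial_rel_def ascends_def cells_def)
  show "labellings (initial_rel m) (cells n k) {1..k * n} \<subseteq> {F \<in> fillings n k. \<forall>i\<in>{1..<m}. ascends k F i}"
  proof
    fix F assume F: "F \<in> labellings (initial_rel m) (cells n k) {1..k * n}"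
    have "F (r, i) < F (r, Suc i)" if "1 \<le> i" "i < m" "r \<in> {1..k}" for i r
    proof -
      have "(r, i) \<in> cells n k" "(r, Suc i) \<in> cells n k" using that assms by (auto simp: cells_def)
      moreover have "initial_rel m (r, i) (r, Suc i)" using that by (simp add: initial_rel_def)
      ultimately show ?thesis using F by (simp add: labellings_def)
    qed
    thus "F \<in> {F \<in> fillings n k. \<forall>i\<in>{1..<m}. ascends k F i}"
      using F by (auto simp: fillings_eq_labellings labellings_def initial_rel_def ascends_def)
  qed
qed

text \<open>
  The generating polynomial of the matches over all fillings with \<open>n\<close> columns.
\<close>

definition match_sum :: "nat \<Rightarrow> 'a::comm_ring_1 \<Rightarrow> nat \<Rightarrow> 'a" where
  "match_sum k x n = (\<Sum>F\<in>fillings n k. x ^ card {i \<in> {1..<n}. ascends k F i})"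

text \<open>
  The last \<open>n - m\<close> columns, labelled by an arbitrary set of the right size, contribute as much as the
  fillings of an array with \<open>n - m\<close> columns: shift the columns and replace the labels by their ranks.
\<close>

lemma sum_final_columns:
  fixes x :: "'a::comm_ring_1"
  assumes "m \<le> n" and V: "finite V" "card V = k * (n - m)"
  shows "(\<Sum>G\<in>labellings (initial_rel m) ({1..k} \<times> {Suc m..n}) V. x ^ card {i \<in> {Suc m..<n}. ascends k G i}) =
         match_sum k x (n - m)"
proof -
  let ?C = "{1..k} \<times> {Suc m..n}" and ?C' = "cells (n - m) k"
  let ?h = "\<lambda>(r, c). (r, c + m)"
  let ?T = "\<lambda>G. \<lambda>p\<in>?C'. rank V (G (?h p))"
  have bij: "bij_betw ?T (labellings (initial_rel m) ?C V) (fillings (n - m) k)"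
    unfolding fillings_eq_labellings V(2) [symmetric]
  proof (rule bij_betw_labellings[OF _ _ bij_betw_rank[OF V(1)] strict_mono_on_rank[OF V(1)]])
    show "bij_betw ?h ?C' ?C"
      by (rule bij_betw_byWitness[where f' = "\<lambda>(r, c). (r, c - m)"])
         (use assms in \<open>auto simp: cells_def\<close>)
  qed (auto simp: cells_def initial_rel_def col_rel_def)
  have "card {i \<in> {Suc m..<n}. ascends k G i} = card {i \<in> {1..<n - m}. ascends k (?T G) i}"
    if G: "G \<in> labellings (initial_rel m) ?C V" for G
  proof (rule bij_betw_same_card [symmetric])
    have ascends: "ascends k (?T G) i \<longleftrightarrow> ascends k G (i + m)" if i: "1 \<le> i" "i < n - m" for i
    proof -
      have "rank V (G (r, i + m)) < rank V (G (r, Suc i + m)) \<longleftrightarrow> G (r, i + m) < G (r, Suc i + m)"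
        if "r \<in> {1..k}" for r
      proof (rule strict_mono_on_less[OF strict_mono_on_rank[OF V(1)]])
        have bij: "bij_betw G ?C V" using G by (simp add: labellings_def)
        show "G (r, i + m) \<in> V" "G (r, Suc i + m) \<in> V"
          using that i by (auto intro!: bij_betw_apply[OF bij])
      qed
      thus ?thesis using i by (auto simp: ascends_def cells_def)
    qed
    show "bij_betw (\<lambda>i. i + m) {i \<in> {1..<n - m}. ascends k (?T G) i} {i \<in> {Suc m..<n}. ascends k G i}"
      by (rule bij_betw_byWitness[where f' = "\<lambda>i. i - m"]) (auto simp: ascends)
  qed
  hence "(\<Sum>G\<in>labellings (initial_rel m) ?C V. x ^ card {i \<in> {Suc m..<n}. ascends k G i}) =
         (\<Sum>G\<in>labellings (initial_rel m) ?C V. x ^ card {i \<in> {1..<n - m}. ascends k (?T G) i})"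
    by (intro sum.cong) auto
  also have "\<dots> = match_sum k x (n - m)"
    unfolding match_sum_def by (rule sum.reindex_bij_betw[OF bij])
  finally show ?thesis .
qed

lemma sum_labellings_initial:
  fixes x :: "'a::comm_ring_1"
  assumes "m \<le> n"
  shows "(\<Sum>F\<in>labellings (initial_rel m) (cells n k) {1..k * n}. x ^ card {i \<in> {Suc m..<n}. ascends k F i}) =
         of_nat ((k * n) choose (k * m)) *
         of_nat (card (labellings tab_rel (cells m k) {1..k * m})) * match_sum k x (n - m)"
proof -
  let ?C1 = "cells m k" and ?C2 = "{1..k} \<times> {Suc m..n}" and ?V = "{1..k * n}"
  define w where "w G = x ^ card {i \<in> {Suc m..<n}. ascends k G i}" for G
  have C: "cells n k = ?C1 \<union> ?C2" using assms by (auto simp: cells_def)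
  have card1: "card ?C1 = k * m" by (simp add: cells_def)
  have w: "w F = w (restrict F ?C2)" for F
  proof -
    have "{i \<in> {Suc m..<n}. ascends k F i} = {i \<in> {Suc m..<n}. ascends k (restrict F ?C2) i}"
      by (auto simp: ascends_def)
    thus ?thesis by (simp add: w_def)
  qed
  have "(\<Sum>F\<in>labellings (initial_rel m) (cells n k) ?V. w F) =
        (\<Sum>F\<in>labellings (initial_rel m) (?C1 \<union> ?C2) ?V. w (restrict F ?C2))"
    unfolding C by (intro sum.cong refl w)
  also have "\<dots> = (\<Sum>S\<in>{S. S \<subseteq> ?V \<and> card S = card ?C1}.
       of_nat (card (labellings (initial_rel m) ?C1 S)) *
       (\<Sum>G\<in>labellings (initial_rel m) ?C2 (?V - S). w G))"
    by (rule sum_labellings_Un) (auto simp: cells_def initial_rel_def col_rel_def)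
  also have "\<dots> = (\<Sum>S\<in>{S. S \<subseteq> ?V \<and> card S = card ?C1}.
       of_nat (card (labellings tab_rel ?C1 {1..k * m})) * match_sum k x (n - m))"
  proof (intro sum.cong refl)
    fix S assume "S \<in> {S. S \<subseteq> ?V \<and> card S = card ?C1}"
    hence S: "S \<subseteq> ?V" "finite S" "card S = k * m" using card1 finite_subset by auto
    have "labellings (initial_rel m) ?C1 S = labellings tab_rel ?C1 S"
      by (rule labellings_cong) (auto simp: initial_rel_def tab_rel_def col_rel_def cells_def)
    moreover have "card (labellings tab_rel ?C1 S) = card (labellings tab_rel ?C1 {1..k * m})"
      using card_labellings_rank[OF S(2)] S(3) by simp
    moreover have "card (?V - S) = k * (n - m)"
      using S by (simp add: card_Diff_subset diff_mult_distrib2)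
    hence "(\<Sum>G\<in>labellings (initial_rel m) ?C2 (?V - S). w G) = match_sum k x (n - m)"
      unfolding w_def using assms by (intro sum_final_columns) auto
    ultimately show "of_nat (card (labellings (initial_rel m) ?C1 S)) *
         (\<Sum>G\<in>labellings (initial_rel m) ?C2 (?V - S). w G) =
       of_nat (card (labellings tab_rel ?C1 {1..k * m})) * match_sum k x (n - m)"
      by simp
  qed
  also have "\<dots> = of_nat ((k * n) choose (k * m)) *
       of_nat (card (labellings tab_rel ?C1 {1..k * m})) * match_sum k x (n - m)"
    using n_subsets[of ?V "k * m"] by (simp add: card1 mult.assoc)
  finally show ?thesis by (simp add: w_def)
qed

lemma match_sum_rec:
  fixes x :: "'a::comm_ring_1"
  assumes "n \<ge> 1"
  shows "match_sum k x n = (\<Sum>m=1..n. (x - 1) ^ (m - 1) *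
           (of_nat ((k * n) choose (k * m)) *
            of_nat (card (labellings tab_rel (cells m k) {1..k * m})) * match_sum k x (n - m)))"
proof -
  let ?w = "\<lambda>m F. x ^ card {i \<in> {Suc m..<n}. ascends k F i}"
  have "match_sum k x n = (\<Sum>F\<in>fillings n k. \<Sum>m=1..n.
          if \<forall>i\<in>{1..<m}. ascends k F i then (x - 1) ^ (m - 1) * ?w m F else 0)"
    unfolding match_sum_def
    by (intro sum.cong refl power_card_eq_sum_initial_run assms)
  also have "\<dots> = (\<Sum>m=1..n. \<Sum>F\<in>fillings n k.
          if \<forall>i\<in>{1..<m}. ascends k F i then (x - 1) ^ (m - 1) * ?w m F else 0)"
    by (rule sum.swap)
  also have "\<dots> = (\<Sum>m=1..n. (x - 1) ^ (m - 1) *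
          (\<Sum>F\<in>{F \<in> fillings n k. \<forall>i\<in>{1..<m}. ascends k F i}. ?w m F))"
    unfolding sum_distrib_left by (intro sum.cong refl sum.inter_filter [symmetric] finite_fillings)
  also have "\<dots> = (\<Sum>m=1..n. (x - 1) ^ (m - 1) *
           (of_nat ((k * n) choose (k * m)) *
            of_nat (card (labellings tab_rel (cells m k) {1..k * m})) * match_sum k x (n - m)))"
    by (intro sum.cong refl) (simp only: fillings_initial_ascents sum_labellings_initial atLeastAtMost_iff)
  finally show ?thesis .
qed

section \<open>The generating function\<close>

lemma falling_mult_fact: "falling (of_nat (m + i)) m * fact i = (fact (m + i) :: 'a::field_char_0)"
proof (induction m)
  case 0
  show ?case by (simp add: falling_def)
next
  case (Suc m)
  have "falling (of_nat (Suc m + i)) (Suc m) =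
        of_nat (Suc m + i) * (falling (of_nat (m + i)) m :: 'a)"
    unfolding falling_def by (subst prod.lessThan_Suc_shift) simp
  thus ?case using Suc.IH by (simp add: mult.assoc)
qed

text \<open>
  The product of the hook lengths of the rectangle with \<open>k\<close> rows and \<open>n\<close> columns: the cell of row \<open>i\<close>,
  counted from the top, and column \<open>c\<close> has hook length \<open>n - c + i\<close>, and these numbers multiply to the
  falling factorial of \<open>n + i - 1\<close> of length \<open>n\<close>.
\<close>

definition hook_prod :: "nat \<Rightarrow> nat \<Rightarrow> 'a::field_char_0" where
  "hook_prod k n = (\<Prod>i=1..k. falling (of_nat (n + i - 1)) n)"

lemma card_standard_rectangle:
  "of_nat (card (labellings tab_rel (cells n k) {1..k * n})) =
     (fact (k * n) / hook_prod k n :: 'a::field_char_0)"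
proof -
  have "hook_prod k n = (\<Prod>i<k. falling (of_nat (n + i)) n :: 'a)"
    unfolding hook_prod_def by (rule prod.reindex_bij_witness[of _ Suc "\<lambda>i. i - 1"]) auto
  also have "\<dots> = (\<Prod>i<k. fact (n + i) / fact i)"
    by (intro prod.cong refl) (simp add: falling_mult_fact [symmetric])
  finally have inv: "(\<Prod>i<k. fact i / fact (n + i)) = (1 / hook_prod k n :: 'a)"
    by (simp add: prod_dividef)
  show ?thesis unfolding card_labellings_rectangle inv by simp
qed

lemma D_series_nth:
  "fps_nth (D_series k (standard_tableaux 2 k) x) n = match_sum k x n / fact (k * n)"
proof (cases "n = 0")
  case True
  have "fillings 0 k = {\<lambda>_. undefined}"
    by (simp add: fillings_eq_labellings cells_def labellings_empty)
  thus ?thesis using True by (simp add: D_series_def match_sum_def)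
next
  case False
  thus ?thesis by (simp add: D_series_def match_sum_def mch_standard_eq)
qed

text \<open>
  The generating function of the nonempty initial groups of columns that form a standard tableau:
  \<open>m\<close> columns have weight \<open>(x - 1)\<^bsup>m - 1\<^esup>\<close>, and the number of tableaux is divided by \<open>(k m)!\<close>.
\<close>

definition run_series :: "nat \<Rightarrow> 'a::field_char_0 \<Rightarrow> 'a fps" where
  "run_series k x = Abs_fps (\<lambda>m. if m = 0 then 0 else (x - 1) ^ (m - 1) / hook_prod k m)"

lemma D_series_mult_run_series:
  "D_series k (standard_tableaux 2 k) x * (1 - run_series k x) = 1"
proof -
  let ?D = "D_series k (standard_tableaux 2 k) x"
  have "?D = 1 + run_series k x * ?D"
  proof (rule fps_ext)
    fix n
    show "fps_nth ?D n = fps_nth (1 + run_series k x * ?D) n"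
    proof (cases "n = 0")
      case True
      thus ?thesis by (simp add: run_series_def D_series_def)
    next
      case False
      hence n: "n \<ge> 1" by simp
      have "fps_nth ?D n = (\<Sum>m=1..n. (x - 1) ^ (m - 1) / hook_prod k m * fps_nth ?D (n - m))"
        unfolding D_series_nth match_sum_rec[OF n]
          sum_divide_distrib card_standard_rectangle
      proof (intro sum.cong refl)
        fix m assume m: "m \<in> {1..n}"
        have "of_nat ((k * n) choose (k * m)) =
              (fact (k * n) / (fact (k * m) * fact (k * (n - m))) :: 'a)"
          using m by (subst binomial_fact) (auto simp: diff_mult_distrib2)
        thus "(x - 1) ^ (m - 1) * (of_nat ((k * n) choose (k * m)) *
               (fact (k * m) / hook_prod k m) * match_sum k x (n - m)) / fact (k * n) =
              (x - 1) ^ (m - 1) / hook_prod k m * (match_sum k x (n - m) / fact (k * (n - m)))"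
          by simp
      qed
      also have "\<dots> = (\<Sum>m=0..n. fps_nth (run_series k x) m * fps_nth ?D (n - m))"
        by (intro sum.mono_neutral_cong_left) (auto simp: run_series_def)
      finally show ?thesis using False by (simp add: fps_mult_nth)
    qed
  qed
  thus ?thesis by (simp add: algebra_simps)
qed

lemma hook_prod_1: "hook_prod k 1 = fact k"
  unfolding hook_prod_def fact_prod by (simp add: falling_def)

lemma D_series_standard:
  assumes "x \<noteq> 1"
  shows "D_series k (standard_tableaux 2 k) x =
           fps_const (1 - x) /
             (fps_const (1 - x) + fps_const ((x - 1) / fact k) * fps_X +
              Abs_fps (\<lambda>n. if n \<ge> 2 then (x - 1) ^ n / hook_prod k n else 0))"
    (is "?D = _ / ?den")
proof -
  have den: "?den = fps_const (1 - x) * (1 - run_series k x)"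
  proof (rule fps_ext)
    fix n
    consider "n = 0" | "n = 1" | m where "n = Suc (Suc m)" by (metis One_nat_def nat.exhaust)
    thus "fps_nth ?den n = fps_nth (fps_const (1 - x) * (1 - run_series k x)) n"
      by cases (auto simp: run_series_def hook_prod_1[unfolded One_nat_def] divide_simps algebra_simps)
  qed
  hence eq: "?D * ?den = fps_const (1 - x)"
    using D_series_mult_run_series[of k x] by (metis mult.left_commute mult.right_neutral)
  have "fps_nth ?den 0 \<noteq> 0" using assms by simp
  hence "?den \<noteq> 0" by (metis fps_zero_nth)
  hence "?D * ?den / ?den = ?D" by (rule nonzero_mult_div_cancel_right)
  thus ?thesis unfolding eq by (rule sym)
qed

lemma indet_neq_1: "indet \<noteq> 1"
proof
  assume "indet = 1"
  hence "to_fract [:0, 1 :: rat:] = to_fract 1" by (simp add: indet_def)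
  thus False by (simp add: one_pCons)
qed

theorem corollary4:
  fixes k :: nat
  assumes "k \<ge> 1"
  shows "D_series k (standard_tableaux 2 k) indet =
           fps_const (1 - indet) /
             (fps_const (1 - indet) + fps_const ((indet - 1) / fact k) * fps_X +
              Abs_fps (\<lambda>n. if n \<ge> 2
                           then (indet - 1) ^ n / (\<Prod>i=1..k. falling (of_nat (n + i - 1)) n)
                           else 0)) \<and>
         A_series k (standard_tableaux 2 k) =
           1 / (1 - fps_const (1 / fact k) * fps_X +
                Abs_fps (\<lambda>n. if n \<ge> 2
                             then (- 1) ^ n / (\<Prod>i=1..k. falling (of_nat (n + i - 1)) n)
                             else 0))"
proof
  show "D_series k (standard_tableaux 2 k) indet =
           fps_const (1 - indet) /
             (fps_const (1 - indet) + fps_const ((indet - 1) / fact k) * fps_X +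
              Abs_fps (\<lambda>n. if n \<ge> 2
                           then (indet - 1) ^ n / (\<Prod>i=1..k. falling (of_nat (n + i - 1)) n)
                           else 0))"
    using D_series_standard[OF indet_neq_1, of k] by (simp only: hook_prod_def)
  have "fps_const ((0 - 1) / fact k) = - fps_const (1 / fact k :: rat)" by simp
  thus "A_series k (standard_tableaux 2 k) =
           1 / (1 - fps_const (1 / fact k) * fps_X +
                Abs_fps (\<lambda>n. if n \<ge> 2
                             then (- 1) ^ n / (\<Prod>i=1..k. falling (of_nat (n + i - 1)) n)
                             else 0))"
    using D_series_standard[of "0 :: rat" k]
    by (simp add: A_series_eq_D_series_0 hook_prod_def del: fps_const_neg cong: if_cong)
qed

end
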